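(* Let $K$ be a field of characteristic not equal to $2$ or $3$, and assume that $2$ is not the cube of an element of $K$. If $f(x)=(x-\gamma)^3+b+\gamma$, with $$b=36t^3\quad\text{and}\quad \gamma=(-2\cdot 6^6)t^9-36t^3,$$ or $$b=-9t^3\quad\text{and}\quad \gamma=9t^3+(2\cdot 3^6)t^9,$$ for some non-zero $t\in K$, then $f$ has a newly reducible second iterate over $K$.
   Context: $f^2$ denotes the second iterate $f\circ f$. $f$ has a newly reducible second iterate over $K$ if $f$ is irreducible over $K$ but $f^2$ is not irreducible over $K$. *)

theory Defs
  imports "HOL-Computational_Algebra.Computational_Algebra"
begin

definition newly_reducible_second_iterate :: "'a::field poly \<Rightarrow> bool" where
  "newly_reducible_second_iterate f \<longleftrightarrow> irreducible f \<and> \<not> irreducible (f \<circ>\<^sub>p f)"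

end

theory Submission
  imports Defs
begin

text \<open>
  Write \<open>y = x - \<gamma>\<close>. Since \<open>y \<circ> f = y^3 + b\<close>, the second iterate
  is \<open>(y^3 + b)^3 + (b + \<gamma>)\<close>. In the two families \<open>b = 36 t^3\<close> and \<open>b = -9 t^3\<close>, and
  \<open>b + \<gamma>\<close> is \<open>2\<close> times the non-zero cube \<open>(-b)^3\<close>.

  Irreducibility of \<open>f = y^3 + (b + \<gamma>)\<close>: a reducible cubic has a root, and a root would make
  \<open>2 b^3\<close>, and hence \<open>2\<close>, a cube.

  Reducibility of the second iterate: let \<open>\<alpha>\<close> be a cube root of \<open>2\<close>. Then
  \<open>(y^3 + b)^3 - 2 b^3\<close> is the norm of \<open>y^3 - b (\<alpha> - 1)\<close> from \<open>K(\<alpha>)\<close>. Ramanujan's identity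
  \<open>9 (\<alpha> - 1) = (1 - \<alpha> + \<alpha>^2)^3\<close>, together with \<open>4 = (\<alpha>^2)^3\<close>, says that
  \<open>b (\<alpha> - 1)\<close> is a cube in \<open>K(\<alpha>)\<close> for both choices of \<open>b\<close>: its cube root \<open>\<theta>\<close> is
  \<open>t (\<alpha>^2 + 2 \<alpha> - 2)\<close> for \<open>b = 36 t^3\<close> and \<open>- t (1 - \<alpha> + \<alpha>^2)\<close> for \<open>b = -9 t^3\<close>.
  The norm of \<open>y - \<theta>\<close> is then a cubic over \<open>K\<close> that divides the second iterate. The two
  factorizations are the ring identities \<open>factorization_36\<close> and \<open>factorization_9\<close>.
\<close>

lemma irreducible_cubic_if_no_root:
  fixes p :: "'a::field poly"
  assumes deg: "degree p = 3" and no_root: "\<And>x. poly p x \<noteq> 0"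
  shows "irreducible p"
proof (rule irreducibleI)
  show "p \<noteq> 0" using deg by auto
  then show "\<not> p dvd 1" using deg by (simp add: is_unit_iff_degree)
next
  fix q r assume pqr: "p = q * r"
  have nz: "q \<noteq> 0" "r \<noteq> 0" using pqr deg by auto
  have sum: "degree q + degree r = 3"
    using pqr deg nz by (simp add: degree_mult_eq)
  have not_linear: "degree s \<noteq> 1" if "s dvd p" for s :: "'a poly"
  proof
    assume "degree s = 1"
    then obtain a c where s: "s = [:a, c:]" "c \<noteq> 0"
      by (rule degree1_coeffs)
    then have "poly s (- a / c) = 0" by simp
    then show False using that no_root by (metis dvdE mult_zero_left poly_mult)
  qed
  have "degree q \<noteq> 1" "degree r \<noteq> 1" using not_linear pqr by auto
  then have "degree q = 0 \<or> degree r = 0" using sum by linarith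
  then show "q dvd 1 \<or> r dvd 1" using nz by (simp add: is_unit_iff_degree)
qed

lemma not_irreducible_if_proper_degree_factor:
  fixes p q r :: "'a::field poly"
  assumes "p = q * r" and "0 < degree q" and "degree q < degree p"
  shows "\<not> irreducible p"
proof
  assume "irreducible p"
  then have "q dvd 1 \<or> r dvd 1" using assms(1) irreducibleD by blast
  moreover have "q \<noteq> 0" "r \<noteq> 0" using assms by auto
  ultimately show False
    using assms by (auto simp: is_unit_iff_degree degree_mult_eq)
qed

text \<open>
  The first factor on the right is the norm of \<open>y - t (\<alpha>^2 + 2 \<alpha> - 2)\<close>. Replacing \<open>y\<close> by
  \<open>\<omega> y\<close>, with \<open>\<omega>\<close> a primitive cube root of unity, fixes the left-hand side, which is
  the product of the three resulting cubics. With \<open>A = y^3 - 36 t^3\<close> and \<open>B = 6 t y^2\<close> this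
  product is \<open>A^3 + B^3 = (A + B) (A^2 - A B + B^2)\<close>.
\<close>
lemma factorization_36:
  fixes t y :: "'a::comm_ring_1"
  shows "(y ^ 3 + 36 * t ^ 3) ^ 3 - 2 * 6 ^ 6 * t ^ 9 =
    (y ^ 3 + 6 * t * y ^ 2 - 36 * t ^ 3) *
    ((y ^ 3 - 36 * t ^ 3) ^ 2 - (y ^ 3 - 36 * t ^ 3) * (6 * t * y ^ 2) + (6 * t * y ^ 2) ^ 2)"
proof -
  have "t ^ 9 = (t ^ 3) ^ 3" by (simp flip: power_mult)
  then show ?thesis by (simp add: algebra_simps power2_eq_square power3_eq_cube)
qed

text \<open>
  The same argument for the norm of \<open>y + t (1 - \<alpha> + \<alpha>^2)\<close>, with the three terms
  \<open>A = y^3 + 9 t^3\<close>, \<open>B = 3 t y^2\<close>, \<open>C = 9 t^2 y\<close>; the product of the three cubics is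
  \<open>A^3 + B^3 + C^3 - 3 A B C\<close>, which has the factor \<open>A + B + C\<close>.
\<close>
lemma factorization_9:
  fixes t y :: "'a::comm_ring_1"
  shows "(y ^ 3 - 9 * t ^ 3) ^ 3 + 2 * 3 ^ 6 * t ^ 9 =
    (y ^ 3 + 3 * t * y ^ 2 + 9 * t ^ 2 * y + 9 * t ^ 3) *
    ((y ^ 3 + 9 * t ^ 3) ^ 2 + (3 * t * y ^ 2) ^ 2 + (9 * t ^ 2 * y) ^ 2
      - (y ^ 3 + 9 * t ^ 3) * (3 * t * y ^ 2)
      - (3 * t * y ^ 2) * (9 * t ^ 2 * y)
      - (9 * t ^ 2 * y) * (y ^ 3 + 9 * t ^ 3))"
proof -
  have "t ^ 9 = (t ^ 3) ^ 3" by (simp flip: power_mult)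
  then show ?thesis by (simp add: algebra_simps power2_eq_square power3_eq_cube)
qed

lemma degree_shifted_monic_cubic:
  fixes a b c \<gamma> :: "'a::field"
  defines "y \<equiv> [:- \<gamma>, 1:]"
  shows "degree (y ^ 3 + [:a:] * y ^ 2 + [:b:] * y + [:c:]) = 3"
proof -
  have "y ^ 3 + [:a:] * y ^ 2 + [:b:] * y + [:c:] = [:c, b, a, 1:] \<circ>\<^sub>p y"
    by (simp add: pcompose_pCons algebra_simps power2_eq_square power3_eq_cube one_pCons
        del: mult_pCons_left mult_pCons_right add_pCons)
  then show ?thesis by (simp add: y_def degree_pcompose)
qed

text \<open>
  The hypothesis \<open>b + \<gamma> = 2 s^3\<close> is what makes \<open>f\<close> itself irreducible: a root \<open>x\<close> of
  \<open>f\<close> would give \<open>((\<gamma> - x) / s)^3 = 2\<close>. The factor in \<open>fac\<close> has degree \<open>3\<close>, whereas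
  \<open>f \<circ> f\<close> has degree \<open>9\<close>.
\<close>
lemma newly_reducible_if_cubic_factor:
  fixes a b d e s \<gamma> :: "'a::field" and q :: "'a poly"
  defines "y \<equiv> [:- \<gamma>, 1:]"
  assumes two: "\<not> (\<exists>u::'a. u ^ 3 = 2)"
    and s: "b + \<gamma> = 2 * s ^ 3" "s \<noteq> 0"
    and fac: "(y ^ 3 + [:b:]) ^ 3 + [:b + \<gamma>:] = (y ^ 3 + [:a:] * y ^ 2 + [:d:] * y + [:e:]) * q"
  shows "newly_reducible_second_iterate (y ^ 3 + [:b:] + [:\<gamma>:])"
proof -
  define f where "f = y ^ 3 + [:b:] + [:\<gamma>:]"
  have deg: "degree f = 3"
    using degree_shifted_monic_cubic[of \<gamma> 0 0 "b + \<gamma>"] by (simp add: f_def y_def add.assoc)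
  have "irreducible f"
  proof (rule irreducible_cubic_if_no_root[OF deg])
    fix x
    show "poly f x \<noteq> 0"
    proof
      assume "poly f x = 0"
      then have "(x - \<gamma>) ^ 3 + 2 * s ^ 3 = 0"
        using s(1) by (simp add: f_def y_def add.assoc)
      moreover have "((\<gamma> - x) / s) ^ 3 * s ^ 3 = (\<gamma> - x) ^ 3"
        using s(2) by (simp add: power_divide)
      moreover have "(\<gamma> - x) ^ 3 = - ((x - \<gamma>) ^ 3)"
        by (simp add: power3_eq_cube algebra_simps)
      ultimately have "((\<gamma> - x) / s) ^ 3 * s ^ 3 = 2 * s ^ 3"
        by (metis add_eq_0_iff minus_minus)
      then have "((\<gamma> - x) / s) ^ 3 = 2"
        using s(2) by simp
      then show False using two by blast
    qed
  qed
  moreover have "\<not> irreducible (f \<circ>\<^sub>p f)"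
  proof (rule not_irreducible_if_proper_degree_factor)
    have "y \<circ>\<^sub>p f = y ^ 3 + [:b:]"
      by (simp add: y_def f_def pcompose_pCons)
    moreover have "f \<circ>\<^sub>p f = (y \<circ>\<^sub>p f) ^ 3 + [:b:] + [:\<gamma>:]"
      by (subst (1) f_def) (simp add: pcompose_add power3_eq_cube pcompose_mult)
    ultimately show "f \<circ>\<^sub>p f = (y ^ 3 + [:a:] * y ^ 2 + [:d:] * y + [:e:]) * q"
      using fac by (simp add: add.assoc)
  qed (use deg degree_shifted_monic_cubic[of \<gamma> a d e] in
      \<open>simp_all add: y_def degree_pcompose\<close>)
  ultimately show ?thesis
    by (simp add: newly_reducible_second_iterate_def f_def)
qed

theorem theorem5p1:
  fixes b \<gamma> :: "'a::field" and f :: "'a poly"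
  assumes "CHAR('a) \<noteq> 2" and "CHAR('a) \<noteq> 3"
    and "\<not> (\<exists>c::'a. c ^ 3 = 2)"
    and "f = [:- \<gamma>, 1:] ^ 3 + [:b:] + [:\<gamma>:]"
    and "\<exists>t::'a. t \<noteq> 0 \<and>
           ((b = 36 * t ^ 3 \<and> \<gamma> = (- 2 * 6 ^ 6) * t ^ 9 - 36 * t ^ 3) \<or>
            (b = - 9 * t ^ 3 \<and> \<gamma> = 9 * t ^ 3 + (2 * 3 ^ 6) * t ^ 9))"
  shows "newly_reducible_second_iterate f"
proof -
  have "(of_nat p :: 'a) \<noteq> 0" if "prime p" "CHAR('a) \<noteq> p" for p
    using that by (auto simp: of_nat_eq_0_iff_char_dvd prime_nat_iff)
  from this[of 2] this[of 3] have "(2::'a) \<noteq> 0" "(3::'a) \<noteq> 0"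
    using assms(1,2) by auto
  then have "(2::'a) ^ 2 * 3 ^ 2 \<noteq> 0" "(3::'a) ^ 2 \<noteq> 0"
    by (simp_all only: mult_eq_0_iff power_eq_0_iff) auto
  then have nz: "(36::'a) \<noteq> 0" "(9::'a) \<noteq> 0"
    by simp_all
  have const: "(numeral n :: 'a poly) = [:numeral n:]" for n
    by (rule numeral_poly)
  obtain t where t: "t \<noteq> 0"
    and cases: "(b = 36 * t ^ 3 \<and> \<gamma> = (- 2 * 6 ^ 6) * t ^ 9 - 36 * t ^ 3) \<or>
      (b = - 9 * t ^ 3 \<and> \<gamma> = 9 * t ^ 3 + (2 * 3 ^ 6) * t ^ 9)"
    using assms(5) by blast
  let ?y = "[:- \<gamma>, 1:]" and ?t = "[:t:]"
  from cases show ?thesis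
  proof
    assume *: "b = 36 * t ^ 3 \<and> \<gamma> = (- 2 * 6 ^ 6) * t ^ 9 - 36 * t ^ 3"
    have sum: "b + \<gamma> = - (2 * 6 ^ 6 * t ^ 9)" using * by simp
    then have twice_cube: "b + \<gamma> = 2 * (- 36 * t ^ 3) ^ 3"
      by (simp add: power_mult_distrib flip: power_mult)
    have nonzero: "- 36 * t ^ 3 \<noteq> 0" using nz t by simp
    have coeffs: "[:b:] = 36 * ?t ^ 3" "[:b + \<gamma>:] = - (2 * 6 ^ 6 * ?t ^ 9)"
      "[:6 * t:] = 6 * ?t" "[:- 36 * t ^ 3:] = - (36 * ?t ^ 3)"
      unfolding sum using * by (simp_all add: const poly_const_pow)
    obtain q where "(?y ^ 3 + 36 * ?t ^ 3) ^ 3 - 2 * 6 ^ 6 * ?t ^ 9 =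
        (?y ^ 3 + 6 * ?t * ?y ^ 2 - 36 * ?t ^ 3) * q"
      using factorization_36 by blast
    then have factor: "(?y ^ 3 + [:b:]) ^ 3 + [:b + \<gamma>:] =
        (?y ^ 3 + [:6 * t:] * ?y ^ 2 + [:0:] * ?y + [:- 36 * t ^ 3:]) * q"
      by (simp only: coeffs pCons_0_0 mult_zero_left add_0_right diff_conv_add_uminus)
    show ?thesis
      unfolding assms(4) by (rule newly_reducible_if_cubic_factor[OF assms(3) twice_cube nonzero factor])
  next
    assume *: "b = - 9 * t ^ 3 \<and> \<gamma> = 9 * t ^ 3 + (2 * 3 ^ 6) * t ^ 9"
    have sum: "b + \<gamma> = 2 * 3 ^ 6 * t ^ 9" using * by simp
    then have twice_cube: "b + \<gamma> = 2 * (9 * t ^ 3) ^ 3"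
      by (simp add: power_mult_distrib flip: power_mult)
    have nonzero: "9 * t ^ 3 \<noteq> 0" using nz t by simp
    have coeffs: "[:b:] = - (9 * ?t ^ 3)" "[:b + \<gamma>:] = 2 * 3 ^ 6 * ?t ^ 9"
      "[:3 * t:] = 3 * ?t" "[:9 * t ^ 2:] = 9 * ?t ^ 2" "[:9 * t ^ 3:] = 9 * ?t ^ 3"
      unfolding sum using * by (simp_all add: const poly_const_pow)
    obtain q where "(?y ^ 3 - 9 * ?t ^ 3) ^ 3 + 2 * 3 ^ 6 * ?t ^ 9 =
        (?y ^ 3 + 3 * ?t * ?y ^ 2 + 9 * ?t ^ 2 * ?y + 9 * ?t ^ 3) * q"
      using factorization_9 by blast
    then have factor: "(?y ^ 3 + [:b:]) ^ 3 + [:b + \<gamma>:] =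
        (?y ^ 3 + [:3 * t:] * ?y ^ 2 + [:9 * t ^ 2:] * ?y + [:9 * t ^ 3:]) * q"
      by (simp only: coeffs diff_conv_add_uminus)
    show ?thesis
      unfolding assms(4) by (rule newly_reducible_if_cubic_factor[OF assms(3) twice_cube nonzero factor])
  qed
qed

end
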